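(* There exists an absolute constant $C>0$ such that for every integer $n\ge 5$ and every simple graph $G$ of order $n$ (not necessarily connected), there exists a switching $s\in\{\pm1\}^n$ such that $$M(s)\ \ge\ n - C\,\frac{n}{(\log n)^{1/4}}.$$ In particular, the maximum of $M(s)$ over $s\in\{\pm1\}^n$ is at least $n(1-o(1))$ as $n\to\infty$, uniformly over all graphs $G$ of order $n$.
   Context: Let $G$ be a finite simple undirected graph on vertex set $\{1,\dots,n\}$ with (0/1) adjacency matrix $A(G)$. A switching is a vector $s=(s_1,\dots,s_n)\in\{\pm1\}^n$. The signed graph $G^{s}$ has underlying graph $G$ and sign $s_is_j$ on each edge $ij$; its adjacency matrix is $A(G^{s})=D_sA(G)D_s$, where $D_s$ is the diagonal matrix with diagonal $s$. An eigenvalue $\lambda$ of $A(G^s)$ is called main if it has an eigenvector not orthogonal to the all-ones vector. Let $\operatorname{spec}(G)$ be the set of distinct eigenvalues of $A(G)$; for $\lambda\in\operatorname{spec}(G)$ let $E_\lambda\subseteq\mathbb{R}^n$ be the $\lambda$-eigenspace of $A(G)$ and $m_\lambda=\dim E_\lambda$. Let $s^\perp=\{x\in\mathbb{R}^n: s^\top x=0\}$. Define $$M(s):=\sum_{\lambda\in\operatorname{spec}(G),\ E_\lambda\not\subseteq s^\perp} m_\lambda .$$ Thus $M(s)$ is the number of main eigenvalues of $G^{s}$ counted with multiplicity. *)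

theory Defs
  imports "Jordan_Normal_Form.Spectral_Radius" "Jordan_Normal_Form.Matrix_Kernel"
begin

definition simple_graph :: "nat \<Rightarrow> nat set set \<Rightarrow> bool" where
  "simple_graph n E \<longleftrightarrow> (\<forall>e\<in>E. e \<subseteq> {0..<n} \<and> card e = 2)"

text \<open>Vertices are numbered \<open>0, \<dots>, n - 1\<close>, matching the row and column indices of
  matrices. The diagonal is zero for a simple graph since \<open>{i, i}\<close> has cardinality one.\<close>

definition adj_mat :: "nat \<Rightarrow> nat set set \<Rightarrow> real mat" where
  "adj_mat n E = mat n n (\<lambda>(i, j). if {i, j} \<in> E then 1 else 0)"

definition switchings :: "nat \<Rightarrow> real vec set" where
  "switchings n = {s \<in> carrier_vec n. \<forall>i<n. s $ i \<in> {-1, 1}}"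

definition eigenspace :: "real mat \<Rightarrow> real \<Rightarrow> real vec set" where
  "eigenspace A \<mu> = {x \<in> carrier_vec (dim_row A). A *\<^sub>v x = \<mu> \<cdot>\<^sub>v x}"

definition eigenspace_dim :: "real mat \<Rightarrow> real \<Rightarrow> nat" where
  "eigenspace_dim A \<mu> =
     vectorspace.dim class_ring (module_vec TYPE(real) (dim_row A)\<lparr>carrier := eigenspace A \<mu>\<rparr>)"

definition perp :: "real vec \<Rightarrow> real vec set" where
  "perp s = {x \<in> carrier_vec (dim_vec s). s \<bullet> x = 0}"

definition main_mult :: "nat \<Rightarrow> nat set set \<Rightarrow> real vec \<Rightarrow> nat" where
  "main_mult n E s =
     (\<Sum>\<mu> \<in> {\<mu> \<in> spectrum (adj_mat n E). \<not> eigenspace (adj_mat n E) \<mu> \<subseteq> perp s}.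
        eigenspace_dim (adj_mat n E) \<mu>)"

lemma adj_mat_carrier: "adj_mat n E \<in> carrier_mat n n"
  by (simp add: adj_mat_def)

lemma eigenspace_eq_mat_kernel:
  assumes "A \<in> carrier_mat n n"
  shows "eigenspace A \<mu> = mat_kernel (char_matrix A \<mu>)"
proof -
  have "(A *\<^sub>v x = \<mu> \<cdot>\<^sub>v x) \<longleftrightarrow> (char_matrix A \<mu> *\<^sub>v x = 0\<^sub>v n)" if x: "x \<in> carrier_vec n" for x
  proof -
    have "char_matrix A \<mu> *\<^sub>v x = A *\<^sub>v x - \<mu> \<cdot>\<^sub>v x"
      using assms x
      by (intro eq_vecI)
        (auto simp: char_matrix_def add_scalar_prod_distrib[of _ n] smult_scalar_prod_distrib[of _ n])
    moreover have "u = w \<longleftrightarrow> u - w = 0\<^sub>v n" if "u \<in> carrier_vec n" "w \<in> carrier_vec n"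
      for u w :: "real vec"
      using that by (auto simp: vec_eq_iff)
    ultimately show ?thesis
      using assms x by (metis mult_mat_vec_carrier smult_carrier_vec)
  qed
  then show ?thesis
    using assms by (auto simp: eigenspace_def mat_kernel_def char_matrix_def)
qed

lemma eigenspace_dim_eq_kernel_dim:
  assumes "A \<in> carrier_mat n n"
  shows "eigenspace_dim A \<mu> = kernel_dim (char_matrix A \<mu>)"
  using assms
  by (simp add: eigenspace_dim_def kernel_dim_def eigenspace_eq_mat_kernel[OF assms]
      char_matrix_def)

text \<open>The sum in \<open>main_mult\<close> and the maximum over all switchings are over finite sets.\<close>

lemma finite_spectrum_adj_mat: "finite (spectrum (adj_mat n E))"
  using card_finite_spectrum(1)[OF adj_mat_carrier] .

lemma finite_switchings: "finite (switchings n)"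
proof -
  have "switchings n \<subseteq> vec_of_list ` {xs. set xs \<subseteq> {-1, 1} \<and> length xs = n}"
  proof
    fix s assume s: "s \<in> switchings n"
    have "set (list_of_vec s) \<subseteq> {-1, 1}" "length (list_of_vec s) = n"
      using s by (auto simp: switchings_def set_list_of_vec vec_set_def)
    then show "s \<in> vec_of_list ` {xs. set xs \<subseteq> {-1, 1} \<and> length xs = n}"
      by (intro image_eqI[of _ _ "list_of_vec s"]) (auto simp: vec_list)
  qed
  then show ?thesis
    by (rule finite_subset) (intro finite_imageI finite_lists_length_eq, simp)
qed

lemma switchings_nonempty: "switchings n \<noteq> {}"
proof -
  have "vec n (\<lambda>_. 1) \<in> switchings n" by (simp add: switchings_def)
  then show ?thesis by blast
qed

end

theory Submission
  imports Defs "Jordan_Normal_Form.Jordan_Normal_Form_Uniqueness" "HOL-Real_Asymp.Real_Asymp"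
begin

text \<open>Choose the switching \<open>s\<close> uniformly at random and let \<open>K = 2 m\<close> be of order \<open>sqrt (ln n)\<close>.
  If the eigenspace of \<open>\<mu>\<close> contains a vector with at least \<open>K\<close> nonzero entries, then by the
  Littlewood-Offord inequality it is orthogonal to \<open>s\<close> with probability \<open>O(K powr (-1/2))\<close>; since the
  multiplicities add up to \<open>n\<close>, these eigenvalues cost \<open>O(n / K powr (1/2))\<close> in expectation.
  Otherwise the whole eigenspace lives on fewer than \<open>K\<close> coordinates, so its dimension is less than
  \<open>K\<close> and \<open>\<mu>\<close> is an eigenvalue of a zero-one matrix of size less than \<open>K\<close>. There are at most
  \<open>K\<^sup>2 2 ^ (K\<^sup>2)\<close> such numbers, which is negligible compared to \<open>n\<close> for this choice of \<open>K\<close>.\<close>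

subsection \<open>The Littlewood-Offord inequality\<close>

text \<open>\<open>signwalk k j\<close> is \<open>2 ^ k\<close> times the expectation of \<open>sgn (j + X)\<close> for the simple random walk \<open>X\<close>
  after \<open>k\<close> steps. For \<open>j \<ge> 0\<close> this is the sum of the \<open>j\<close> largest binomial coefficients
  \<open>k choose i\<close>, which is the extremal value in the Littlewood-Offord problem for \<open>j\<close> targets.\<close>

fun signwalk :: "nat \<Rightarrow> int \<Rightarrow> int" where
  "signwalk 0 j = sgn j"
| "signwalk (Suc k) j = signwalk k (j - 1) + signwalk k (j + 1)"

lemma signwalk_minus: "signwalk k (- j) = - signwalk k j"
proof (induction k arbitrary: j)
  case (Suc k)
  have "- j - 1 = - (j + 1)" "- j + 1 = - (j - 1)" by auto
  then show ?case unfolding signwalk.simps by (simp only: Suc.IH)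
qed (simp add: sgn_minus)

lemma signwalk_zero [simp]: "signwalk k 0 = 0"
  using signwalk_minus[of k 0] by simp

text \<open>Averaging over two neighbours preserves concavity on the nonnegative integers; at the
  boundary \<open>j = 1\<close> the induction closes because oddness gives the value 0 at 0.\<close>

lemma signwalk_concave: "j \<ge> 1 \<Longrightarrow> signwalk k (j - 1) + signwalk k (j + 1) \<le> 2 * signwalk k j"
proof (induction k arbitrary: j)
  case (Suc k)
  show ?case
  proof (cases "j = 1")
    case True
    then show ?thesis using Suc.IH[of 2] by simp
  next
    case False
    then have "signwalk k (j - 2) + signwalk k j \<le> 2 * signwalk k (j - 1)" "signwalk k j + signwalk k (j + 2) \<le> 2 * signwalk k (j + 1)"
      using Suc.IH[of "j - 1"] Suc.IH[of "j + 1"] Suc.prems by (auto simp: algebra_simps)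
    then show ?thesis by (simp add: algebra_simps)
  qed
qed (auto simp: sgn_if)

lemma signwalk_slope_antimono:
  assumes "1 \<le> a" "a \<le> b"
  shows "signwalk k (b + 1) - signwalk k b \<le> signwalk k a - signwalk k (a - 1)"
  using assms(2,1)
proof (induction b rule: int_ge_induct)
  case base
  then show ?case using signwalk_concave[of a k] by simp
next
  case (step b)
  then show ?case using signwalk_concave[of "b + 1" k] by simp
qed

text \<open>Moving two arguments symmetrically towards their centre cannot decrease the sum of a
  concave function, and for \<open>d = 1\<close> that sum is the recursion itself.
  \<open>int d \<le> j\<close> keeps all arguments nonnegative, where concavity is
  available.\<close>

lemma signwalk_spread:
  assumes "d \<ge> 1" "int d \<le> j"
  shows "signwalk k (j - int d) + signwalk k (j + int d) \<le> signwalk (Suc k) j"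
  using assms
proof (induction d rule: dec_induct)
  case (step d)
  have "signwalk k (j + int d + 1) - signwalk k (j + int d) \<le> signwalk k (j - int d) - signwalk k (j - int d - 1)"
    using step by (intro signwalk_slope_antimono) auto
  then show ?case using step by (simp add: algebra_simps)
qed simp

text \<open>The sign changes only for walks ending at \<open>k - 2 * i\<close>, which are counted by
  \<open>k choose i\<close>; the induction is Pascal's rule. The second clause covers positions left
  of the support and supplies the missing neighbour when \<open>i = 0\<close>.\<close>

lemma signwalk_diff_binomial:
  "signwalk k (2 * int i - int k + 1) - signwalk k (2 * int i - int k - 1) = 2 * int (k choose i)"
  "j \<le> - int k - 2 \<Longrightarrow> signwalk k (j + 1) = signwalk k (j - 1)"
proof (induction k arbitrary: i j)
  case 0
  { case 1 then show ?case by (cases i) (auto simp: sgn_if) }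
  { case 2 then show ?case by (auto simp: sgn_if) }
next
  case (Suc k)
  { case 1
    show ?case
    proof (cases i)
      case 0
      have "- int k - 2 + 1 = - int k - 1" "- int k - 2 - 1 = - int k - 3" by simp_all
      then have "signwalk k (- int k - 1) = signwalk k (- int k - 3)"
        using Suc.IH(2)[of "- int k - 2"] by (metis order_refl)
      moreover have a: "2 * int i - int (Suc k) + 1 - 1 = - int k - 1"
        "2 * int i - int (Suc k) + 1 + 1 = - int k + 1"
        "2 * int i - int (Suc k) - 1 - 1 = - int k - 3"
        "2 * int i - int (Suc k) - 1 + 1 = - int k - 1"
        using 0 by simp_all
      ultimately show ?thesis
        unfolding signwalk.simps a using 0 Suc.IH(1)[of 0] by simp
    next
      case (Suc i')
      then show ?thesis
        using Suc.IH(1)[of i] Suc.IH(1)[of i'] by (simp add: algebra_simps)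
    qed }
  { case 2
    then show ?case using Suc.IH(2)[of "j - 1"] Suc.IH(2)[of "j + 1"] by (simp add: algebra_simps) }
qed

lemma signwalk_even_one: "signwalk (2 * m) 1 = int (2 * m choose m)"
  using signwalk_diff_binomial(1)[of "2 * m" m] signwalk_minus[of "2 * m" 1] by simp

text \<open>Induction works on the squared form: consecutive central binomials have ratio
  \<open>2 * (2 * m + 1) / (m + 1)\<close>, and the step reduces to
  \<open>(2 * m + 1) * (2 * m + 3) \<le> (2 * m + 2) ^ 2\<close>.\<close>

lemma central_binomial_upper:
  "real (2 * m choose m) \<le> 4 ^ m / sqrt (2 * real m + 1)"
proof -
  have "real (2 * m choose m) ^ 2 * (2 * real m + 1) \<le> 16 ^ m"
  proof (induction m)
    case (Suc m)
    let ?c = "real (2 * m choose m)" and ?d = "real (2 * Suc m choose Suc m)"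
    have square: "(real (Suc m))\<^sup>2 * (d ^ 2 * (2 * real (Suc m) + 1)) =
        4 * (2 * real m + 1) * (2 * real m + 3) * (c ^ 2 * (2 * real m + 1))"
      if "real (Suc m) * d = 2 * (2 * real m + 1) * c" for c d :: real
    proof -
      have "(real (Suc m))\<^sup>2 * d ^ 2 = (2 * (2 * real m + 1) * c)\<^sup>2"
        by (simp only: that flip: power_mult_distrib)
      then have "(real (Suc m))\<^sup>2 * (d ^ 2 * (2 * real (Suc m) + 1)) =
          (2 * (2 * real m + 1) * c)\<^sup>2 * (2 * real (Suc m) + 1)"
        by (simp only: mult.assoc[of "(real (Suc m))\<^sup>2", symmetric])
      then show ?thesis by (simp add: power2_eq_square algebra_simps)
    qed
    have "Suc m * (2 * Suc m choose Suc m) = 2 * (2 * m + 1) * (2 * m choose m)"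
    proof -
      have "Suc m * (2 * Suc m choose Suc m) = 2 * Suc m * (Suc (2 * m) choose m)"
        using binomial_absorption[of m "2 * Suc m"] by (simp del: binomial_Suc_Suc)
      also have "Suc (2 * m) choose m = Suc (2 * m) choose Suc m"
        using binomial_symmetric[of m "Suc (2 * m)"] by (simp del: binomial_Suc_Suc)
      also have "2 * Suc m * (Suc (2 * m) choose Suc m) = 2 * (Suc m * (Suc (2 * m) choose Suc m))"
        by (simp only: mult.assoc)
      also have "\<dots> = 2 * (2 * m + 1) * (2 * m choose m)"
        using binomial_absorption[of m "Suc (2 * m)"] by (simp del: binomial_Suc_Suc)
      finally show ?thesis .
    qed
    from arg_cong[OF this, of real] have rec: "real (Suc m) * ?d = 2 * (2 * real m + 1) * ?c"
      by (simp only: of_nat_mult of_nat_add of_nat_numeral of_nat_1)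
    have "(real (Suc m))\<^sup>2 * (?d ^ 2 * (2 * real (Suc m) + 1)) =
        4 * (2 * real m + 1) * (2 * real m + 3) * (?c ^ 2 * (2 * real m + 1))"
      by (rule square[OF rec])
    also have "\<dots> \<le> 4 * (2 * real m + 1) * (2 * real m + 3) * 16 ^ m"
      using Suc.IH by (rule mult_left_mono) simp
    also have "\<dots> \<le> (16 * (real (Suc m))\<^sup>2) * 16 ^ m"
      by (intro mult_right_mono) (auto simp: power2_eq_square algebra_simps)
    finally have "(real (Suc m))\<^sup>2 * (?d ^ 2 * (2 * real (Suc m) + 1)) \<le> (real (Suc m))\<^sup>2 * 16 ^ Suc m"
      by (simp only: power_Suc ac_simps)
    then show ?case by (rule mult_left_le_imp_le) simp
  qed simp
  then have "sqrt (real (2 * m choose m) ^ 2 * (2 * real m + 1)) \<le> sqrt (16 ^ m)"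
    by (rule real_sqrt_le_mono)
  moreover have "sqrt (16 ^ m) = (4::real) ^ m"
    by (rule real_sqrt_unique) (simp_all add: power2_eq_square flip: power_mult_distrib)
  ultimately have "real (2 * m choose m) * sqrt (2 * real m + 1) \<le> 4 ^ m"
    by (simp only: real_sqrt_mult real_sqrt_abs abs_of_nat)
  then show ?thesis by (simp add: pos_le_divide_eq)
qed

text \<open>Concavity at 1 and the value 0 at 0 make \<open>signwalk k 1 / 2 ^ k\<close>
  nonincreasing in \<open>k\<close>, so the case \<open>2 * m\<close> bounds every later
  \<open>k\<close>, odd ones included.\<close>

lemma signwalk_one_bound:
  assumes "2 * m \<le> k"
  shows "real_of_int (signwalk k 1) \<le> 2 ^ k / sqrt (2 * real m + 1)"
  using assms
proof (induction k rule: dec_induct)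
  case base
  then show ?case using central_binomial_upper[of m] by (simp add: signwalk_even_one power_mult)
next
  case (step k)
  have "signwalk (Suc k) 1 \<le> 2 * signwalk k 1" using signwalk_concave[of 1 k] by simp
  then have "real_of_int (signwalk (Suc k) 1) \<le> 2 * real_of_int (signwalk k 1)" by linarith
  then show ?case using step by simp
qed

text \<open>Conditioning on whether \<open>i\<close> is chosen replaces \<open>T\<close> by \<open>T \<inter> T'\<close> and \<open>T \<union> T'\<close> for a
  translate \<open>T' \<noteq> T\<close>, whose sizes are \<open>card T \<mp> d\<close> with \<open>d \<ge> 1\<close>.\<close>

lemma card_subset_sums_le:
  fixes v :: "'a \<Rightarrow> real"
  assumes "finite I" "finite T"
  shows "int (card {S \<in> Pow I. sum v S \<in> T}) \<le>
    2 ^ card {i \<in> I. v i = 0} * signwalk (card {i \<in> I. v i \<noteq> 0}) (int (card T))"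
  using assms
proof (induction I arbitrary: T rule: finite_induct)
  case empty
  have "{S \<in> Pow {}. sum v S \<in> T} = (if 0 \<in> T then {{}} else {})" by auto
  then show ?case using empty by (auto simp: sgn_if card_gt_0_iff)
next
  case (insert i I)
  let ?N = "\<lambda>T. {S \<in> Pow I. sum v S \<in> T}"
  let ?T' = "(\<lambda>x. x - v i) ` T"
  have fin: "finite (?N T)" for T using insert.hyps by auto
  have "{S \<in> Pow (insert i I). sum v S \<in> T} = ?N T \<union> Set.insert i ` ?N ?T'"
    (is "?L = ?R")
  proof (intro equalityI subsetI)
    fix S assume S: "S \<in> ?L"
    show "S \<in> ?R"
    proof (cases "i \<in> S")
      case True
      have "finite S" using S insert.hyps by (auto intro: finite_subset[of _ "Set.insert i I"])
      then have "sum v S = v i + sum v (S - {i})"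
        using True by (rule sum.remove)
      then have "sum v (S - {i}) = sum v S - v i" by simp
      then have "S - {i} \<in> ?N ?T'" using S by auto
      moreover have "S = Set.insert i (S - {i})" using True by auto
      ultimately show ?thesis by blast
    qed (use S in auto)
  next
    fix S assume "S \<in> ?R"
    then consider "S \<in> ?N T" | S' where "S = Set.insert i S'" "S' \<in> ?N ?T'" by blast
    then show "S \<in> ?L"
    proof cases
      case 2
      then have "finite S'" "i \<notin> S'" using insert.hyps by (auto intro: finite_subset[of _ I])
      then have "sum v S = v i + sum v S'" using 2 by simp
      then show ?thesis using 2 by auto
    qed auto
  qed
  moreover have "?N T \<inter> Set.insert i ` ?N ?T' = {}" using insert.hyps by auto
  moreover have "card (Set.insert i ` ?N ?T') = card (?N ?T')"
    using insert.hyps by (intro card_image) (auto simp: inj_on_def)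
  ultimately have card: "card {S \<in> Pow (insert i I). sum v S \<in> T} = card (?N T) + card (?N ?T')"
    using fin by (simp add: card_Un_disjoint)
  show ?case
  proof (cases "v i = 0")
    case True
    have "{j \<in> insert i I. v j = 0} = Set.insert i {j \<in> I. v j = 0}"
      "{j \<in> insert i I. v j \<noteq> 0} = {j \<in> I. v j \<noteq> 0}" using True by auto
    then show ?thesis
      using insert.IH[OF insert.prems] insert.hyps True unfolding card by simp
  next
    case False
    have z: "{j \<in> insert i I. v j = 0} = {j \<in> I. v j = 0}"
      "{j \<in> insert i I. v j \<noteq> 0} = Set.insert i {j \<in> I. v j \<noteq> 0}" using False by auto
    let ?k = "card {j \<in> I. v j \<noteq> 0}" and ?z = "card {j \<in> I. v j = 0}"
    have k: "card {j \<in> insert i I. v j \<noteq> 0} = Suc ?k" unfolding z using insert.hyps by simp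
    have fT: "finite ?T'" using insert.prems by simp
    have cT: "card ?T' = card T" by (intro card_image) (auto simp: inj_on_def)
    define d where "d = card T - card (T \<inter> ?T')"
    have le: "card (T \<inter> ?T') \<le> card T" using insert.prems by (intro card_mono) auto
    have un: "card (T \<union> ?T') + card (T \<inter> ?T') = 2 * card T"
      using card_Un_Int[OF insert.prems fT] cT by simp
    have dI: "int (card (T \<inter> ?T')) = int (card T) - int d"
      and dU: "int (card (T \<union> ?T')) = int (card T) + int d"
      using le un unfolding d_def by auto
    \<comment> \<open>Counting is modular in the target set, so the equally large sets
      \<open>T\<close> and \<open>?T'\<close> can be traded for their union and
      intersection.\<close>
    have "card (?N T) + card (?N ?T') = card (?N T \<union> ?N ?T') + card (?N T \<inter> ?N ?T')"
      by (rule card_Un_Int[OF fin fin])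
    also have "?N T \<union> ?N ?T' = ?N (T \<union> ?T')" by auto
    also have "?N T \<inter> ?N ?T' = ?N (T \<inter> ?T')" by auto
    finally have "int (card {S \<in> Pow (insert i I). sum v S \<in> T}) =
        int (card (?N (T \<union> ?T'))) + int (card (?N (T \<inter> ?T')))"
      unfolding card by simp
    also have "\<dots> \<le> 2 ^ ?z * signwalk ?k (int (card (T \<union> ?T'))) + 2 ^ ?z * signwalk ?k (int (card (T \<inter> ?T')))"
      using insert.prems by (intro add_mono insert.IH) auto
    also have "\<dots> = 2 ^ ?z * (signwalk ?k (int (card T) - int d) + signwalk ?k (int (card T) + int d))"
      unfolding dI dU by (simp add: algebra_simps)
    also have "\<dots> \<le> 2 ^ ?z * signwalk (Suc ?k) (int (card T))"
    proof (cases "T = {}")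
      case True
      then show ?thesis by (simp add: d_def signwalk_minus[of _ 1, simplified])
    next
      case ne: False
      \<comment> \<open>A nonempty finite set of reals is not invariant under a nonzero translation,
        since its maximum would move.\<close>
      have "d \<ge> 1"
      proof (rule ccontr)
        assume "\<not> d \<ge> 1"
        then have "card (T \<inter> ?T') = card T" using le by (simp add: d_def)
        then have "T \<inter> ?T' = T" using insert.prems by (intro card_subset_eq) auto
        then have "?T' = T" using cT insert.prems by (metis card_subset_eq fT inf_le2)
        then have "Max ?T' = Max T" by simp
        moreover have "Max ?T' = Max T - v i" using insert.prems ne
          by (intro mono_Max_commute[symmetric]) (auto simp: mono_def)
        ultimately show False using False by simp
      qed
      then have "signwalk ?k (int (card T) - int d) + signwalk ?k (int (card T) + int d) \<le> signwalk (Suc ?k) (int (card T))"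
        by (rule signwalk_spread) (use dI in linarith)
      then show ?thesis by (intro mult_left_mono) auto
    qed
    finally show ?thesis unfolding z(1) k .
  qed
qed

text \<open>This is the case of a single target. Each zero coefficient merely doubles the count, so
  the decay comes from the nonzero ones alone.\<close>

theorem Littlewood_Offord:
  fixes v :: "'a \<Rightarrow> real"
  assumes "finite I" "2 * m \<le> card {i \<in> I. v i \<noteq> 0}"
  shows "real (card {S \<in> Pow I. sum v S = c}) \<le> 2 ^ card I / sqrt (2 * real m + 1)"
proof -
  let ?z = "card {i \<in> I. v i = 0}" and ?k = "card {i \<in> I. v i \<noteq> 0}"
  have "card I = ?z + ?k"
  proof -
    have "I = {i \<in> I. v i = 0} \<union> {i \<in> I. v i \<noteq> 0}" by auto
    then show ?thesis
      using card_Un_disjoint[of "{i \<in> I. v i = 0}" "{i \<in> I. v i \<noteq> 0}"] assms(1) by auto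
  qed
  have "int (card {S \<in> Pow I. sum v S = c}) \<le> 2 ^ ?z * signwalk ?k 1"
    using card_subset_sums_le[OF assms(1), of "{c}" v] by simp
  then have "real (card {S \<in> Pow I. sum v S = c}) \<le> 2 ^ ?z * real_of_int (signwalk ?k 1)"
    using of_int_le_iff[where ?'a = real, THEN iffD2] by fastforce
  also have "\<dots> \<le> 2 ^ ?z * (2 ^ ?k / sqrt (2 * real m + 1))"
    by (intro mult_left_mono signwalk_one_bound assms) auto
  also have "\<dots> = 2 ^ card I / sqrt (2 * real m + 1)"
    unfolding \<open>card I = ?z + ?k\<close> by (simp add: power_add)
  finally show ?thesis .
qed

subsection \<open>Real symmetric matrices\<close>

text \<open>Moving the matrix across the Hermitian product \<open>v \<bullet>c v\<close>, which is
  nonzero, identifies \<open>z\<close> with its conjugate.\<close>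

lemma symmetric_eigenvalue_real:
  fixes A :: "real mat"
  assumes A: "A \<in> carrier_mat n n" and sym: "A\<^sup>T = A"
    and ev: "eigenvalue (map_mat complex_of_real A) z"
  shows "z \<in> \<real>"
proof -
  let ?M = "map_mat complex_of_real A"
  have M: "?M \<in> carrier_mat n n" using A by simp
  from ev obtain v where v: "v \<in> carrier_vec n" "v \<noteq> 0\<^sub>v n" "?M *\<^sub>v v = z \<cdot>\<^sub>v v"
    using A by (auto simp: eigenvalue_def eigenvector_def)
  have MT: "?M\<^sup>T = ?M" by (metis map_mat_transpose sym)
  have conjM: "conjugate (?M *\<^sub>v v) = ?M *\<^sub>v conjugate v"
    using A v(1) by (intro eq_vecI) (auto simp: scalar_prod_def)
  have "z * (v \<bullet>c v) = (?M *\<^sub>v v) \<bullet>c v" using v by simp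
  also have "\<dots> = v \<bullet> (?M *\<^sub>v conjugate v)"
    using transpose_vec_mult_scalar[OF M, of "conjugate v" v] v(1) MT by simp
  also have "\<dots> = cnj z * (v \<bullet>c v)"
    using v conjM[symmetric] by (simp add: conjugate_smult_vec)
  finally have "z = cnj z" using v by simp
  then show ?thesis by (simp add: complex_eq_iff complex_is_Real_iff)
qed

text \<open>The complex linear factors all have real roots, so the factorization descends along the
  injective embedding. Splitting over the reals is what gives a real Jordan normal form.\<close>

lemma symmetric_char_poly_splits:
  fixes A :: "real mat"
  assumes A: "A \<in> carrier_mat n n" and sym: "A\<^sup>T = A"
  shows "\<exists>es. char_poly A = (\<Prod>e\<leftarrow>es. [:- e, 1:])"
proof -
  interpret h: map_poly_inj_idom_hom complex_of_real ..
  let ?M = "map_mat complex_of_real A"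
  have M: "?M \<in> carrier_mat n n" using A by simp
  obtain as where as: "char_poly ?M = (\<Prod>a\<leftarrow>as. [:- a, 1:])"
    using char_poly_factorized[OF M] by blast
  have re: "complex_of_real (Re a) = a" if "a \<in> set as" for a
  proof -
    have "poly (char_poly ?M) a = 0" unfolding as by (rule linear_poly_root[OF that])
    then have "a \<in> \<real>"
      using symmetric_eigenvalue_real[OF A sym] eigenvalue_root_char_poly[OF M] by blast
    then show ?thesis by simp
  qed
  have "map_poly complex_of_real (char_poly A) = (\<Prod>a\<leftarrow>as. [:- a, 1:])"
    by (metis as of_real_hom.char_poly_hom[OF A])
  also have "\<dots> = (\<Prod>a\<leftarrow>as. map_poly complex_of_real [:- Re a, 1:])"
    using re by (intro arg_cong[of _ _ prod_list] map_cong) auto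
  also have "\<dots> = map_poly complex_of_real (\<Prod>a\<leftarrow>as. [:- Re a, 1:])"
    by (simp add: h.hom_prod_list o_def)
  finally have "char_poly A = (\<Prod>e\<leftarrow>map Re as. [:- e, 1:])"
    by (simp add: o_def)
  then show ?thesis by blast
qed

text \<open>By symmetry the squared norm of \<open>B *\<^sub>v x\<close> is the inner product of
  \<open>B *\<^sub>v (B *\<^sub>v x)\<close> with \<open>x\<close>.\<close>

lemma symmetric_kernel_square:
  fixes B :: "real mat"
  assumes B: "B \<in> carrier_mat n n" and sym: "B\<^sup>T = B"
  shows "mat_kernel (B * B) = mat_kernel B"
proof -
  have "B *\<^sub>v x = 0\<^sub>v n \<longleftrightarrow> (B * B) *\<^sub>v x = 0\<^sub>v n" if x: "x \<in> carrier_vec n" for x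
  proof
    assume "(B * B) *\<^sub>v x = 0\<^sub>v n"
    then have "B *\<^sub>v (B *\<^sub>v x) = 0\<^sub>v n" using B x by simp
    moreover have "(B *\<^sub>v x) \<bullet>c (B *\<^sub>v x) = (B *\<^sub>v (B *\<^sub>v x)) \<bullet> x"
      using transpose_vec_mult_scalar[OF B x, of "B *\<^sub>v x"] sym B x
      by (simp add: comm_scalar_prod[of _ n])
    ultimately have "(B *\<^sub>v x) \<bullet>c (B *\<^sub>v x) = 0" using x by simp
    then show "B *\<^sub>v x = 0\<^sub>v n"
      using conjugate_square_eq_0_vec[of "B *\<^sub>v x" n] B x by simp
  next
    assume "B *\<^sub>v x = 0\<^sub>v n"
    then show "(B * B) *\<^sub>v x = 0\<^sub>v n" using B x by (simp, auto simp: scalar_prod_def)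
  qed
  then show ?thesis using B by (auto simp: mat_kernel_def)
qed

lemma jordan_matrix_blocks_one:
  "jordan_matrix (map (\<lambda>e. (1, e)) es) =
    mat (length es) (length es) (\<lambda>(i, j). if i = j then es ! i else 0)"
proof (induction es)
  case Nil
  then show ?case by (intro eq_matI) auto
next
  case (Cons e es)
  have d: "sum_list (map fst (map (\<lambda>e. (1, e)) es)) = length es" by (induction es) auto
  show ?case
    unfolding list.map jordan_matrix_Cons d Cons.IH
    by (intro eq_matI) (auto simp: nth_Cons' less_Suc_eq_0_disj split: if_splits)
qed

text \<open>For symmetric \<open>A\<close>, \<open>A - \<mu>\<close> and its square have the same kernel, which rules out Jordan
  blocks of size larger than one.\<close>

lemma symmetric_diagonalizable:
  fixes A :: "real mat"
  assumes A: "A \<in> carrier_mat n n" and sym: "A\<^sup>T = A"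
  obtains es P Q where "length es = n"
    and "similar_mat_wit A (mat n n (\<lambda>(i, j). if i = j then es ! i else 0)) P Q"
    and "\<And>\<mu>. eigenspace_dim A \<mu> = count_list es \<mu>"
proof -
  obtain n_as where jnf: "jordan_nf A n_as"
    using symmetric_char_poly_splits[OF A sym] jordan_nf_exists[OF A] by blast
  have entry: "A $$ (i, j) = A $$ (j, i)" if "i < n" "j < n" for i j
    by (metis A carrier_matD index_transpose_mat(1) sym that)
  have kd: "dim_gen_eigenspace A \<mu> 2 = dim_gen_eigenspace A \<mu> 1" for \<mu> :: real
  proof -
    let ?B = "char_matrix A \<mu>"
    have B: "?B \<in> carrier_mat n n" using A by (simp add: char_matrix_def)
    have sB: "?B\<^sup>T = ?B"
      using A entry by (intro eq_matI) (auto simp: char_matrix_def)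
    have "?B ^\<^sub>m 2 = ?B * ?B" using B by (simp add: numeral_2_eq_2)
    moreover have "?B ^\<^sub>m 1 = ?B" using B by simp
    ultimately show ?thesis
      using symmetric_kernel_square[OF B sB] B
      by (simp add: dim_gen_eigenspace_def kernel_dim_def)
  qed
  have one: "fst x = 1" if x: "x \<in> set n_as" for x
  proof -
    obtain m \<mu> where xm: "x = (m, \<mu>)" by force
    let ?xs = "map fst (filter (\<lambda>(n, e). e = \<mu>) n_as)"
    have m: "m \<in> set ?xs" using x xm by force
    have "m \<noteq> 0" using jnf x xm unfolding jordan_nf_def by force
    \<comment> \<open>A block of size \<open>n\<close> contributes \<open>min k n\<close> to the
      generalized eigenspace of order \<open>k\<close>, so a block larger than one would separate
      orders 1 and 2.\<close>
    have "(\<Sum>n\<leftarrow>ys. min 1 n) < (\<Sum>n\<leftarrow>ys. min 2 n)" if "m \<in> set ys" "m > 1" for ys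
      using that
    proof (induction ys)
      case (Cons y ys)
      have le: "(\<Sum>n\<leftarrow>ys. min 1 n) \<le> (\<Sum>n\<leftarrow>ys. min 2 n)"
        by (intro sum_list_mono) auto
      show ?case
      proof (cases "m \<in> set ys")
        case True
        then show ?thesis using Cons by auto
      next
        case False
        then show ?thesis using Cons.prems le by auto
      qed
    qed simp
    then have "\<not> m > 1"
      using kd[of \<mu>] m unfolding dim_gen_eigenspace[OF jnf] by fastforce
    then show ?thesis using \<open>m \<noteq> 0\<close> xm by simp
  qed
  define es where "es = map snd n_as"
  have n_as: "n_as = map (\<lambda>e. (1, e)) es"
    unfolding es_def map_map o_def using one by (intro map_idI[symmetric]) (simp add: prod_eq_iff)
  have J: "jordan_matrix n_as = mat (length es) (length es) (\<lambda>(i, j). if i = j then es ! i else 0)"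
    unfolding n_as by (rule jordan_matrix_blocks_one)
  obtain P Q where w: "similar_mat_wit A (jordan_matrix n_as) P Q"
    using jnf unfolding jordan_nf_def similar_mat_def by blast
  have len: "length es = n"
    using similar_mat_witD2(5)[OF A w] unfolding J by auto
  have "eigenspace_dim A \<mu> = count_list es \<mu>" for \<mu> :: real
  proof -
    have "eigenspace_dim A \<mu> = dim_gen_eigenspace A \<mu> 1"
      using A by (simp add: eigenspace_dim_eq_kernel_dim[OF A] dim_gen_eigenspace_def char_matrix_def)
    also have "\<dots> = count_list es \<mu>"
      unfolding dim_gen_eigenspace[OF jnf] unfolding n_as by (induction es) auto
    finally show ?thesis .
  qed
  then show ?thesis using that[OF len w[unfolded J len]] by blast
qed

text \<open>The total weight \<open>n\<close> makes main multiplicity and lost multiplicity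
  complementary, so it is enough to bound the loss.\<close>

lemma sum_eigenspace_dim:
  fixes A :: "real mat"
  assumes A: "A \<in> carrier_mat n n" and sym: "A\<^sup>T = A"
  shows "(\<Sum>\<mu>\<in>spectrum A. eigenspace_dim A \<mu>) = n"
proof -
  obtain es P Q where len: "length es = n"
    and w: "similar_mat_wit A (mat n n (\<lambda>(i, j). if i = j then es ! i else 0)) P Q"
    and dim: "\<And>\<mu>. eigenspace_dim A \<mu> = count_list es \<mu>"
    by (rule symmetric_diagonalizable[OF A sym]) blast
  let ?D = "mat n n (\<lambda>(i, j). if i = j then es ! i else (0::real))"
  have "char_poly A = char_poly ?D"
    using w by (intro char_poly_similar) (auto simp: similar_mat_def)
  also have "\<dots> = (\<Prod>a\<leftarrow>diag_mat ?D. [:- a, 1:])"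
    by (intro char_poly_upper_triangular[of _ n]) (auto simp: upper_triangular_def)
  also have "diag_mat ?D = es"
    using len by (auto simp: diag_mat_def intro!: nth_equalityI)
  finally have cp: "char_poly A = (\<Prod>a\<leftarrow>es. [:- a, 1:])" .
  have "spectrum A = set es"
    unfolding spectrum_root_char_poly[OF A] cp
    by (auto simp: poly_prod_list prod_list_zero_iff)
  then show ?thesis using dim len by (simp add: sum_count_set)
qed

text \<open>The bound is read off from the determinant of an invertible matrix of eigenvectors: its
  columns for \<open>\<mu>\<close> must be matched with distinct rows in \<open>W\<close>.\<close>

lemma eigenspace_dim_le_support:
  fixes A :: "real mat"
  assumes A: "A \<in> carrier_mat n n" and sym: "A\<^sup>T = A" and W: "finite W"
    and supp: "\<And>x i. x \<in> eigenspace A \<mu> \<Longrightarrow> i < n \<Longrightarrow> x $ i \<noteq> 0 \<Longrightarrow> i \<in> W"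
  shows "eigenspace_dim A \<mu> \<le> card W"
proof -
  obtain es P Q where len: "length es = n"
    and w: "similar_mat_wit A (mat n n (\<lambda>(i, j). if i = j then es ! i else 0)) P Q"
    and dim: "\<And>\<mu>. eigenspace_dim A \<mu> = count_list es \<mu>"
    by (rule symmetric_diagonalizable[OF A sym]) blast
  let ?D = "mat n n (\<lambda>(i, j). if i = j then es ! i else (0::real))"
  note ws = similar_mat_witD2[OF A w]
  have D: "?D \<in> carrier_mat n n" by simp
  have "det P * det Q = 1"
    using det_mult[OF ws(6,7)] ws(1) by simp
  then have "det P \<noteq> 0" by auto
  then obtain p where p: "p permutes {0..<n}" and nz: "(\<Prod>i = 0..<n. P $$ (i, p i)) \<noteq> 0"
    unfolding det_def'[OF ws(6)] by (metis (mono_tags, lifting) mem_Collect_eq mult_zero_right sum.neutral)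
  have AP: "A * P = P * ?D"
  proof -
    have "A * P = P * ?D * Q * P" using ws(3) by simp
    also have "\<dots> = P * ?D * (Q * P)"
      by (rule assoc_mult_mat[of _ n n _ n _ n]) (use ws D in auto)
    also have "\<dots> = P * ?D" unfolding ws(2) by (rule right_mult_one_mat[of _ n]) (use ws D in auto)
    finally show ?thesis .
  qed
  have colP: "col P j \<in> eigenspace A (es ! j)" if j: "j < n" for j
  proof -
    have "A *\<^sub>v col P j = es ! j \<cdot>\<^sub>v col P j"
    proof (rule eq_vecI)
      fix i assume "i < dim_vec (es ! j \<cdot>\<^sub>v col P j)"
      then have i: "i < n" using ws by simp
      have "(A *\<^sub>v col P j) $ i = (A * P) $$ (i, j)"
        using A ws i j by simp
      also have "\<dots> = (\<Sum>k = 0..<n. P $$ (i, k) * (if k = j then es ! k else 0))"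
        unfolding AP using ws(6) i j by (simp add: scalar_prod_def)
      also have "\<dots> = P $$ (i, j) * es ! j"
        using j by (simp add: if_distrib cong: if_cong)
      finally show "(A *\<^sub>v col P j) $ i = (es ! j \<cdot>\<^sub>v col P j) $ i"
        using ws i j by simp
    qed (use A ws in auto)
    then show ?thesis using A ws by (auto simp: eigenspace_def)
  qed
  \<comment> \<open>A nonzero term of the Leibniz expansion of \<open>det P\<close> maps the columns of \<open>P\<close> belonging to
    \<open>\<mu>\<close> injectively into their common support.\<close>
  have "{j. j < n \<and> es ! j = \<mu>} \<subseteq> p ` W"
  proof safe
    fix j assume j: "j < n" "\<mu> = es ! j"
    then obtain i where i: "i < n" "p i = j"
      using permutes_image[OF p] by (metis atLeastLessThan_iff imageE zero_le)
    have "P $$ (i, j) \<noteq> 0" using nz i by auto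
    then have "i \<in> W" using supp[of "col P j" i] colP[OF j(1)] j i ws by simp
    then show "j \<in> p ` W" using i by blast
  qed
  then have "card {j. j < n \<and> es ! j = \<mu>} \<le> card W"
    by (meson W card_image_le card_mono finite_imageI le_trans)
  then show ?thesis
    using dim len by (simp add: count_list_eq_length_filter length_filter_conv_card eq_commute)
qed

subsection \<open>Random switchings\<close>

text \<open>For all but finitely many \<open>t\<close>, the support of \<open>x + t y\<close> is the union of the supports of
  \<open>x\<close> and \<open>y\<close>.\<close>

lemma eigenspace_max_support:
  fixes A :: "real mat"
  assumes A: "A \<in> carrier_mat n n"
  obtains x where "x \<in> eigenspace A \<mu>"
    and "\<And>y. y \<in> eigenspace A \<mu> \<Longrightarrow> {i. i < n \<and> y $ i \<noteq> 0} \<subseteq> {i. i < n \<and> x $ i \<noteq> 0}"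
proof -
  let ?E = "eigenspace A \<mu>" and ?s = "\<lambda>x. {i. i < n \<and> x $ i \<noteq> (0::real)}"
  have "0\<^sub>v n \<in> ?E" using A by (auto simp: eigenspace_def intro!: eq_vecI)
  moreover have "\<forall>y. y \<in> ?E \<longrightarrow> card (?s y) < Suc n"
    using card_mono[of "{..<n}"] by (auto simp: subset_iff less_Suc_eq_le)
  ultimately have "\<exists>x. x \<in> ?E \<and> (\<forall>y. y \<in> ?E \<longrightarrow> card (?s y) \<le> card (?s x))"
    by (rule ex_has_greatest_nat[where f = "\<lambda>y. card (?s y)"])
  then obtain x where x: "x \<in> ?E" and max: "\<And>y. y \<in> ?E \<Longrightarrow> card (?s y) \<le> card (?s x)"
    by blast
  have "?s y \<subseteq> ?s x" if y: "y \<in> ?E" for y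
  proof -
    have xy: "x \<in> carrier_vec n" "y \<in> carrier_vec n" using x y A by (auto simp: eigenspace_def)
    \<comment> \<open>Where \<open>y $ i = 0\<close>, division by zero yields 0, so such coordinates
      only exclude \<open>t = 0\<close>.\<close>
    obtain t where t: "t \<notin> (\<lambda>i. - x $ i / y $ i) ` {..<n}"
      using ex_new_if_finite[OF infinite_UNIV_char_0, of "(\<lambda>i. - x $ i / y $ i) ` {..<n}"] by blast
    let ?z = "x + t \<cdot>\<^sub>v y"
    have "A *\<^sub>v ?z = A *\<^sub>v x + t \<cdot>\<^sub>v (A *\<^sub>v y)"
      using A xy by (simp add: mult_add_distrib_mat_vec mult_mat_vec)
    also have "\<dots> = \<mu> \<cdot>\<^sub>v ?z"
      using x y xy by (intro eq_vecI) (auto simp: eigenspace_def algebra_simps)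
    finally have z: "?z \<in> ?E" using A xy by (auto simp: eigenspace_def)
    have sub: "?s x \<union> ?s y \<subseteq> ?s ?z"
    proof
      fix i assume i: "i \<in> ?s x \<union> ?s y"
      have "?z $ i \<noteq> 0"
      proof
        assume "?z $ i = 0"
        then have e: "x $ i + t * y $ i = 0" using i xy by auto
        then have "y $ i \<noteq> 0" using i by auto
        then have "t = - x $ i / y $ i" using e by (simp add: field_simps)
        then show False using t i by auto
      qed
      then show "i \<in> ?s ?z" using i by auto
    qed
    have "?s x = ?s ?z"
      using sub max[OF z] by (intro card_seteq) auto
    then show ?thesis using sub by blast
  qed
  then show ?thesis using that x by blast
qed

text \<open>Indexing switchings by their positive sets turns averages into sums over a power set and
  sign sums into the subset sums counted above.\<close>

definition switching_vec :: "nat \<Rightarrow> nat set \<Rightarrow> real vec" where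
  "switching_vec n S = vec n (\<lambda>i. if i \<in> S then 1 else - 1)"

lemma switching_vec_in_switchings: "switching_vec n S \<in> switchings n"
  by (simp add: switching_vec_def switchings_def)

lemma scalar_prod_switching_vec:
  assumes "x \<in> carrier_vec n" "S \<subseteq> {0..<n}"
  shows "switching_vec n S \<bullet> x = 2 * sum (($) x) S - sum (($) x) {0..<n}"
proof -
  have "switching_vec n S \<bullet> x = (\<Sum>i = 0..<n. 2 * (if i \<in> S then x $ i else 0) - x $ i)"
    using assms(1) by (auto simp: switching_vec_def scalar_prod_def intro!: sum.cong)
  also have "\<dots> = 2 * sum (($) x) S - sum (($) x) {0..<n}"
    using assms(2) by (simp add: sum_subtractf sum.If_cases Int_absorb1 flip: sum_distrib_left)
  finally show ?thesis .
qed

text \<open>Orthogonality says that the subset sum over the positive set is exactly half the total,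
  a single Littlewood-Offord target.\<close>

lemma card_orthogonal_switchings:
  assumes x: "x \<in> carrier_vec n" "2 * m \<le> card {i. i < n \<and> x $ i \<noteq> 0}"
  shows "real (card {S \<in> Pow {0..<n}. switching_vec n S \<bullet> x = 0}) \<le> 2 ^ n / sqrt (2 * real m + 1)"
proof -
  have "{S \<in> Pow {0..<n}. switching_vec n S \<bullet> x = 0} =
      {S \<in> Pow {0..<n}. sum (($) x) S = sum (($) x) {0..<n} / 2}"
    using scalar_prod_switching_vec[OF x(1)] by auto
  moreover have "{i \<in> {0..<n}. x $ i \<noteq> 0} = {i. i < n \<and> x $ i \<noteq> 0}" by auto
  ultimately show ?thesis
    using Littlewood_Offord[of "{0..<n}" m "($) x" "sum (($) x) {0..<n} / 2"] x(2) by simp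
qed

section \<open>Eigenspaces of small support and the averaging argument\<close>

definition zero_one_mat :: "nat \<Rightarrow> (nat \<times> nat) set \<Rightarrow> real mat" where
  "zero_one_mat w F = mat w w (\<lambda>ij. if ij \<in> F then 1 else 0)"

definition small_eigenvalues :: "nat \<Rightarrow> real set" where
  "small_eigenvalues K = (\<Union>w<K. \<Union>F\<in>Pow ({0..<w} \<times> {0..<w}). spectrum (zero_one_mat w F))"

lemma zero_one_mat_carrier: "zero_one_mat w F \<in> carrier_mat w w"
  by (simp add: zero_one_mat_def)

lemma finite_small_eigenvalues: "finite (small_eigenvalues K)"
  unfolding small_eigenvalues_def
  using card_finite_spectrum(1)[OF zero_one_mat_carrier] by auto

lemma card_small_eigenvalues: "card (small_eigenvalues K) \<le> K * (2 ^ (K * K) * K)"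
proof -
  have F: "card (\<Union>F\<in>Pow ({0..<w} \<times> {0..<w}). spectrum (zero_one_mat w F)) \<le> 2 ^ (K * K) * K"
    if "w < K" for w
  proof -
    have "card (\<Union>F\<in>Pow ({0..<w} \<times> {0..<w}). spectrum (zero_one_mat w F))
        \<le> (\<Sum>F\<in>Pow ({0..<w} \<times> {0..<w}). card (spectrum (zero_one_mat w F)))"
      by (intro card_UN_le) auto
    also have "\<dots> \<le> (\<Sum>F\<in>Pow ({0..<w} \<times> {0..<w}). w)"
      by (intro sum_mono card_finite_spectrum(2)[OF zero_one_mat_carrier])
    also have "\<dots> = 2 ^ (w * w) * w" by (simp add: card_Pow card_cartesian_product)
    also have "\<dots> \<le> 2 ^ (K * K) * K"
      using that by (intro mult_le_mono power_increasing) auto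
    finally show ?thesis .
  qed
  have "card (small_eigenvalues K) \<le>
      (\<Sum>w<K. card (\<Union>F\<in>Pow ({0..<w} \<times> {0..<w}). spectrum (zero_one_mat w F)))"
    unfolding small_eigenvalues_def by (intro card_UN_le) auto
  also have "\<dots> \<le> (\<Sum>w<K. 2 ^ (K * K) * K)" by (intro sum_mono F) auto
  finally show ?thesis by simp
qed

text \<open>An eigenvector supported on \<open>W\<close> restricts to an eigenvector of the principal submatrix
  indexed by \<open>W\<close>.\<close>

lemma small_support_eigenvalue:
  fixes A :: "real mat"
  assumes A: "A \<in> carrier_mat n n" and A01: "\<And>i j. i < n \<Longrightarrow> j < n \<Longrightarrow> A $$ (i, j) \<in> {0, 1}"
    and x: "eigenvector A x \<mu>" and small: "card {i. i < n \<and> x $ i \<noteq> 0} < K"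
  shows "\<mu> \<in> small_eigenvalues K"
proof -
  let ?W = "{i. i < n \<and> x $ i \<noteq> 0}"
  define w where "w = card ?W"
  obtain f where f: "bij_betw f {0..<w} ?W"
    using ex_bij_betw_nat_finite[of ?W] unfolding w_def by auto
  have xn: "x \<in> carrier_vec n" "x \<noteq> 0\<^sub>v n" and Ax: "A *\<^sub>v x = \<mu> \<cdot>\<^sub>v x"
    using x A by (auto simp: eigenvector_def)
  have fW: "f i \<in> ?W" if "i < w" for i using f that by (auto simp: bij_betw_def)
  define F where "F = {(i, j). i < w \<and> j < w \<and> A $$ (f i, f j) = 1}"
  define y where "y = vec w (\<lambda>i. x $ f i)"
  have B: "zero_one_mat w F $$ (i, j) = A $$ (f i, f j)" if "i < w" "j < w" for i j
    using that A01[of "f i" "f j"] fW by (auto simp: zero_one_mat_def F_def)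
  have "zero_one_mat w F *\<^sub>v y = \<mu> \<cdot>\<^sub>v y"
  proof (rule eq_vecI)
    fix i assume "i < dim_vec (\<mu> \<cdot>\<^sub>v y)"
    then have i: "i < w" by (simp add: y_def)
    have "(zero_one_mat w F *\<^sub>v y) $ i = (\<Sum>j = 0..<w. A $$ (f i, f j) * x $ f j)"
      using i B zero_one_mat_carrier[of w F] by (auto simp: scalar_prod_def y_def intro!: sum.cong)
    also have "\<dots> = (\<Sum>k\<in>?W. A $$ (f i, k) * x $ k)"
      by (rule sum.reindex_bij_betw[OF f])
    also have "\<dots> = (\<Sum>k = 0..<n. A $$ (f i, k) * x $ k)"
      by (intro sum.mono_neutral_left) auto
    also have "\<dots> = (A *\<^sub>v x) $ f i"
      using A xn fW[OF i] by (auto simp: scalar_prod_def intro!: sum.cong)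
    also have "\<dots> = (\<mu> \<cdot>\<^sub>v y) $ i" using Ax xn fW[OF i] i by (simp add: y_def)
    finally show "(zero_one_mat w F *\<^sub>v y) $ i = (\<mu> \<cdot>\<^sub>v y) $ i" .
  qed (simp add: y_def zero_one_mat_def)
  moreover have "y \<noteq> 0\<^sub>v w"
  proof -
    have "?W \<noteq> {}"
    proof
      assume "?W = {}"
      then have "x = 0\<^sub>v n" using xn(1) by (intro eq_vecI) auto
      then show False using xn(2) by simp
    qed
    then have "0 < w" by (simp add: w_def card_gt_0_iff)
    then have "y $ 0 \<noteq> 0" using fW[of 0] by (simp add: y_def)
    then show ?thesis using \<open>0 < w\<close> by auto
  qed
  ultimately have "eigenvector (zero_one_mat w F) y \<mu>"
    unfolding eigenvector_def using zero_one_mat_carrier[of w F] by (simp add: y_def)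
  then have "\<mu> \<in> spectrum (zero_one_mat w F)"
    by (auto simp: spectrum_def eigenvalue_def)
  moreover have "F \<in> Pow ({0..<w} \<times> {0..<w})" by (auto simp: F_def)
  ultimately show ?thesis using small unfolding small_eigenvalues_def w_def[symmetric] by blast
qed

text \<open>First-moment argument: exchange the sums over switchings and eigenvalues and bound the
  average loss. The first error term comes from eigenspaces of large support, the second from the
  small eigenvalues; \<open>m\<close> stays free to balance them.\<close>

lemma exists_switching_main_mult:
  "\<exists>s\<in>switchings n. real (main_mult n E s) \<ge>
    real n - (real n / sqrt (2 * real m + 1) + real ((2 * m) ^ 3 * 2 ^ (2 * m * (2 * m))))"
proof -
  let ?A = "adj_mat n E" and ?K = "2 * m" and ?P = "Pow {0..<n}"
  let ?m = "eigenspace_dim ?A" and ?q = "1 / sqrt (2 * real m + 1)"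
  let ?bad = "\<lambda>S \<mu>. eigenspace ?A \<mu> \<subseteq> perp (switching_vec n S)"
  note A = adj_mat_carrier[of n E]
  have sym: "?A\<^sup>T = ?A" by (intro eq_matI) (auto simp: adj_mat_def insert_commute)
  have fin: "finite (spectrum ?A)" by (rule finite_spectrum_adj_mat)
  have total: "(\<Sum>\<mu>\<in>spectrum ?A. ?m \<mu>) = n" by (rule sum_eigenspace_dim[OF A sym])
  define loss where "loss S = (\<Sum>\<mu>\<in>{\<mu> \<in> spectrum ?A. ?bad S \<mu>}. ?m \<mu>)" for S
  have main: "main_mult n E (switching_vec n S) + loss S = n" for S
  proof -
    have "spectrum ?A = {\<mu> \<in> spectrum ?A. \<not> ?bad S \<mu>} \<union> {\<mu> \<in> spectrum ?A. ?bad S \<mu>}" by auto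
    then have "(\<Sum>\<mu>\<in>spectrum ?A. ?m \<mu>) = main_mult n E (switching_vec n S) + loss S"
      unfolding main_mult_def loss_def using fin
      by (subst sum.union_disjoint[symmetric]) auto
    then show ?thesis using total by simp
  qed
  \<comment> \<open>One bound serves both cases: with large support the first summand suffices,
    otherwise the second does, using the trivial count \<open>2 ^ n\<close> of switchings.\<close>
  have each: "real (?m \<mu>) * real (card {S \<in> ?P. ?bad S \<mu>}) \<le>
      2 ^ n * (real (?m \<mu>) * ?q + (if \<mu> \<in> small_eigenvalues ?K then real ?K else 0))"
    if mu: "\<mu> \<in> spectrum ?A" for \<mu>
  proof -
    obtain x where x: "x \<in> eigenspace ?A \<mu>"
      and max: "\<And>y. y \<in> eigenspace ?A \<mu> \<Longrightarrow>
        {i. i < n \<and> y $ i \<noteq> 0} \<subseteq> {i. i < n \<and> x $ i \<noteq> 0}"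
      by (rule eigenspace_max_support[OF A]) blast
    have xn: "x \<in> carrier_vec n" using x A by (auto simp: eigenspace_def)
    show ?thesis
    proof (cases "?K \<le> card {i. i < n \<and> x $ i \<noteq> 0}")
      case True
      have "{S \<in> ?P. ?bad S \<mu>} \<subseteq> {S \<in> ?P. switching_vec n S \<bullet> x = 0}"
        using x by (auto simp: perp_def)
      then have "card {S \<in> ?P. ?bad S \<mu>} \<le> card {S \<in> ?P. switching_vec n S \<bullet> x = 0}"
        by (intro card_mono) auto
      then have "real (card {S \<in> ?P. ?bad S \<mu>}) \<le> 2 ^ n * ?q"
        using card_orthogonal_switchings[OF xn True] by simp
      then have "real (?m \<mu>) * real (card {S \<in> ?P. ?bad S \<mu>}) \<le> real (?m \<mu>) * (2 ^ n * ?q)"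
        by (rule mult_left_mono) simp
      also have "\<dots> = 2 ^ n * (real (?m \<mu>) * ?q + 0)" by simp
      also have "\<dots> \<le> 2 ^ n * (real (?m \<mu>) * ?q + (if \<mu> \<in> small_eigenvalues ?K then real ?K else 0))"
        by (intro mult_left_mono add_left_mono) auto
      finally show ?thesis .
    next
      case False
      \<comment> \<open>The vector \<open>x\<close> has not been shown to be nonzero, so a genuine
        eigenvector is taken; its support lies in that of \<open>x\<close>.\<close>
      obtain v where v: "eigenvector ?A v \<mu>"
        using mu by (auto simp: spectrum_def eigenvalue_def)
      then have "v \<in> eigenspace ?A \<mu>" by (auto simp: eigenspace_def eigenvector_def)
      then have "card {i. i < n \<and> v $ i \<noteq> 0} \<le> card {i. i < n \<and> x $ i \<noteq> 0}"
        by (intro card_mono max) auto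
      then have small: "\<mu> \<in> small_eigenvalues ?K"
        using False by (intro small_support_eigenvalue[OF A _ v]) (auto simp: adj_mat_def)
      have "?m \<mu> \<le> card {i. i < n \<and> x $ i \<noteq> 0}"
        by (rule eigenspace_dim_le_support[OF A sym]) (use max in auto)
      then have mK: "real (?m \<mu>) \<le> real ?K" using False by linarith
      have "card {S \<in> ?P. ?bad S \<mu>} \<le> card ?P" by (intro card_mono) auto
      then have "card {S \<in> ?P. ?bad S \<mu>} \<le> 2 ^ n" by (simp only: card_Pow finite_atLeastLessThan card_atLeastLessThan diff_zero)
      then have "real (card {S \<in> ?P. ?bad S \<mu>}) \<le> real (2 ^ n)" by (rule of_nat_mono)
      then have "real (card {S \<in> ?P. ?bad S \<mu>}) \<le> 2 ^ n" by simp
      then have "real (?m \<mu>) * real (card {S \<in> ?P. ?bad S \<mu>}) \<le> real ?K * 2 ^ n"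
        using mK by (intro mult_mono) auto
      also have "\<dots> \<le> 2 ^ n * (real (?m \<mu>) * ?q + real ?K)"
        by (simp add: algebra_simps)
      finally show ?thesis using small by simp
    qed
  qed
  define L where "L = real n * ?q + real (card (small_eigenvalues ?K)) * real ?K"
  have "(\<Sum>S\<in>?P. real (loss S)) = (\<Sum>S\<in>?P. \<Sum>\<mu>\<in>spectrum ?A. if ?bad S \<mu> then real (?m \<mu>) else 0)"
    unfolding loss_def of_nat_sum by (intro sum.cong refl sum.inter_filter fin)
  also have "\<dots> = (\<Sum>\<mu>\<in>spectrum ?A. \<Sum>S\<in>?P. if ?bad S \<mu> then real (?m \<mu>) else 0)"
    by (rule sum.swap)
  also have "\<dots> = (\<Sum>\<mu>\<in>spectrum ?A. real (?m \<mu>) * real (card {S \<in> ?P. ?bad S \<mu>}))"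
  proof (intro sum.cong refl)
    fix \<mu>
    have "(\<Sum>S\<in>?P. if ?bad S \<mu> then real (?m \<mu>) else 0) = (\<Sum>S\<in>{S \<in> ?P. ?bad S \<mu>}. real (?m \<mu>))"
      by (rule sum.inter_filter[symmetric]) simp
    also have "\<dots> = real (?m \<mu>) * real (card {S \<in> ?P. ?bad S \<mu>})"
      by (simp only: sum_constant mult.commute)
    finally show "(\<Sum>S\<in>?P. if ?bad S \<mu> then real (?m \<mu>) else 0) =
      real (?m \<mu>) * real (card {S \<in> ?P. ?bad S \<mu>})" .
  qed
  also have "\<dots> \<le> (\<Sum>\<mu>\<in>spectrum ?A.
      2 ^ n * (real (?m \<mu>) * ?q + (if \<mu> \<in> small_eigenvalues ?K then real ?K else 0)))"
    by (intro sum_mono each)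
  also have "\<dots> = 2 ^ n * ((\<Sum>\<mu>\<in>spectrum ?A. real (?m \<mu>)) * ?q +
      (\<Sum>\<mu>\<in>spectrum ?A. if \<mu> \<in> small_eigenvalues ?K then real ?K else 0))"
    by (simp only: distrib_left sum.distrib sum_distrib_left sum_distrib_right)
  also have "(\<Sum>\<mu>\<in>spectrum ?A. real (?m \<mu>)) = real n"
    unfolding of_nat_sum[symmetric] total ..
  also have "(\<Sum>\<mu>\<in>spectrum ?A. if \<mu> \<in> small_eigenvalues ?K then real ?K else 0) =
      real (card (spectrum ?A \<inter> small_eigenvalues ?K)) * real ?K"
    using fin by (simp add: sum.If_cases)
  also have "2 ^ n * (real n * ?q + real (card (spectrum ?A \<inter> small_eigenvalues ?K)) * real ?K) \<le> 2 ^ n * L"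
    unfolding L_def using finite_small_eigenvalues
    by (intro mult_left_mono add_left_mono mult_right_mono of_nat_mono card_mono) auto
  finally have avg: "(\<Sum>S\<in>?P. real (loss S)) \<le> 2 ^ n * L" .
  \<comment> \<open>The power set has \<open>2 ^ n\<close> members, so \<open>L\<close> bounds the
    average loss and some member does not exceed it.\<close>
  have "\<exists>S\<in>?P. real (loss S) \<le> L"
  proof (rule ccontr)
    assume "\<not> ?thesis"
    then have "(\<Sum>S\<in>?P. L) < (\<Sum>S\<in>?P. real (loss S))"
      by (intro sum_strict_mono) (auto simp: not_le)
    then show False using avg by (simp add: card_Pow)
  qed
  then obtain S where S: "real (loss S) \<le> L" by blast
  \<comment> \<open>Two factors of the cube come from counting the small eigenvalues, the third from
    bounding each multiplicity by \<open>?K\<close>.\<close>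
  have "real (card (small_eigenvalues ?K)) * real ?K \<le> real (?K * (2 ^ (?K * ?K) * ?K)) * real ?K"
    using card_small_eigenvalues[of ?K] by (intro mult_right_mono of_nat_mono) auto
  also have "\<dots> = real (?K ^ 3 * 2 ^ (?K * ?K))"
    by (simp only: power3_eq_cube of_nat_mult ac_simps)
  finally have "real (card (small_eigenvalues ?K)) * real ?K \<le> real (?K ^ 3 * 2 ^ (?K * ?K))" .
  from add_left_mono[OF this, of "real n * ?q"] have "L \<le> real n / sqrt (2 * real m + 1) + real (?K ^ 3 * 2 ^ (?K * ?K))"
    by (simp only: L_def times_divide_eq_right mult_1_right)
  moreover have "real (main_mult n E (switching_vec n S)) = real n - real (loss S)"
    using main[of S] by linarith
  ultimately have "real (main_mult n E (switching_vec n S)) \<ge>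
      real n - (real n / sqrt (2 * real m + 1) + real (?K ^ 3 * 2 ^ (?K * ?K)))"
    using S by linarith
  then show ?thesis using switching_vec_in_switchings by blast
qed

text \<open>The factor 1/4 makes \<open>(2 * m) ^ 2\<close> at most a quarter of
  \<open>ln n\<close>, so the exponential is at most the fourth root of \<open>n\<close>. The
  constant 3 is 2 from the square-root term plus 1 from the small eigenvalues.\<close>

lemma loss_estimate:
  assumes n: "n \<ge> 5"
  defines "m \<equiv> nat \<lfloor>sqrt (ln (real n)) / 4\<rfloor>"
  shows "real n / sqrt (2 * real m + 1) + real ((2 * m) ^ 3 * 2 ^ (2 * m * (2 * m)))
    \<le> 3 * (real n / ln (real n) powr (1/4))"
proof -
  define l where "l = ln (real n)"
  \<comment> \<open>With \<open>l = y ^ 4\<close> and \<open>real n = e ^ 4\<close>, the remaining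
    comparisons become polynomial in \<open>y\<close>, \<open>e\<close> and
    \<open>K\<close>.\<close>
  define y where "y = l powr (1/4)"
  define e where "e = exp (l / 4)"
  define K where "K = 2 * m"
  have l: "l > 0" using n by (simp add: l_def)
  have y: "y > 0" using l by (simp add: y_def)
  have y2: "y ^ 2 = sqrt l"
    using l by (simp add: y_def powr_half_sqrt[symmetric] powr_power)
  have y4: "y ^ 4 = l"
    using l by (simp add: y_def powr_power)
  have e4: "e ^ 4 = real n"
    using n by (simp add: e_def l_def flip: exp_of_nat_mult)
  have m1: "real m \<le> y ^ 2 / 4" and m2: "y ^ 2 / 4 < real m + 1"
    using l unfolding y2 m_def l_def by (simp_all add: floor_less_iff) linarith+
  have "(y / 2)\<^sup>2 \<le> 2 * real m + 1"
    using m2 by (simp add: power_divide)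
  then have "y / 2 \<le> sqrt (2 * real m + 1)"
    using real_le_rsqrt by blast
  then have "real n / sqrt (2 * real m + 1) \<le> real n / (y / 2)"
    using y by (intro divide_left_mono) auto
  then have large: "real n / sqrt (2 * real m + 1) \<le> 2 * (real n / y)" by (simp add: mult.commute)
  have "1 + l / 4 \<le> e" unfolding e_def by (rule exp_ge_add_one_self)
  moreover have "y \<le> 1 + y ^ 4 / 4"
  proof -
    \<comment> \<open>The right-hand side expands to \<open>y ^ 4 - 4 * y + 4\<close>.\<close>
    have "0 \<le> (y\<^sup>2 - 1)\<^sup>2 + 2 * (y - 1)\<^sup>2 + 1" by simp
    then show ?thesis by (simp add: power2_eq_square power4_eq_xxxx algebra_simps)
  qed
  ultimately have ye: "y \<le> e" and le: "l / 4 \<le> e" unfolding y4 by linarith+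
  have K2: "real K ^ 2 \<le> l / 4"
  proof -
    have "real K \<le> y ^ 2 / 2" using m1 by (simp add: K_def)
    then have "real K ^ 2 \<le> (y ^ 2 / 2) ^ 2" by (intro power_mono) auto
    also have "\<dots> = l / 4" by (simp add: power_divide y4 flip: power_mult)
    finally show ?thesis .
  qed
  have "real (K ^ 3) \<le> real (K ^ 4)"
    by (cases "K = 0") (auto intro!: power_increasing of_nat_mono simp del: of_nat_power)
  also have "\<dots> = (real K ^ 2) ^ 2" by (simp flip: power_mult)
  also have "\<dots> \<le> e ^ 2" using K2 le by (intro power_mono) auto
  finally have K3: "real (K ^ 3) \<le> e ^ 2" .
  have "(2::real) ^ (K * K) \<le> exp 1 ^ (K * K)"
    using exp_ge_add_one_self[of 1] by (intro power_mono) auto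
  also have "\<dots> = exp (real K ^ 2)" by (simp add: power2_eq_square flip: exp_of_nat_mult)
  also have "\<dots> \<le> e" using K2 by (simp add: e_def)
  \<comment> \<open>The four factors \<open>e\<close> making up \<open>n\<close> are spent as two on
    \<open>K ^ 3\<close>, one on the power of 2 and one on \<open>y\<close>.\<close>
  finally have "real (K ^ 3) * 2 ^ (K * K) * y \<le> e ^ 2 * e * e"
    using K3 ye y by (intro mult_mono) auto
  also have "\<dots> = real n" unfolding e4[symmetric] by (simp add: power2_eq_square power4_eq_xxxx)
  finally have "real (K ^ 3 * 2 ^ (K * K)) \<le> real n / y"
    using y by (simp add: pos_le_divide_eq)
  then show ?thesis
    using large unfolding K_def y_def l_def by linarith
qed

theorem theorem1p4:
  shows "(\<exists>C::real. C > 0 \<and>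
      (\<forall>n::nat. n \<ge> 5 \<longrightarrow> (\<forall>E. simple_graph n E \<longrightarrow>
        (\<exists>s\<in>switchings n.
          real (main_mult n E s) \<ge> real n - C * (real n / (ln (real n)) powr (1/4))))))
    \<and> (\<exists>\<epsilon> :: nat \<Rightarrow> real. \<epsilon> \<longlonglongrightarrow> 0 \<and>
      (\<forall>n::nat. \<forall>E. simple_graph n E \<longrightarrow>
        real (Max (main_mult n E ` switchings n)) \<ge> real n * (1 - \<epsilon> n)))"
proof (intro conjI exI[of _ "3::real"] allI impI)
  have main: "\<exists>s\<in>switchings n. real (main_mult n E s) \<ge> real n - 3 * (real n / ln (real n) powr (1/4))"
    if "n \<ge> 5" for n E
    using exists_switching_main_mult[where n = n and E = E and m = "nat \<lfloor>sqrt (ln (real n)) / 4\<rfloor>"] loss_estimate[OF that]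
    by (meson diff_left_mono order_trans)
  then show "\<exists>s\<in>switchings n. real (main_mult n E s) \<ge> real n - 3 * (real n / ln (real n) powr (1/4))"
    if "n \<ge> 5" for n E
    using that .
  \<comment> \<open>For \<open>n < 5\<close> the value 1 makes the bound trivial and avoids small
    logarithms; the limit is unaffected by finitely many terms.\<close>
  let ?\<epsilon> = "\<lambda>n. if n \<ge> 5 then 3 / ln (real n) powr (1/4) else 1"
  have "(\<lambda>n. 3 / ln (real n) powr (1/4)) \<longlonglongrightarrow> 0" by real_asymp
  moreover have "\<forall>\<^sub>F n in sequentially. 3 / ln (real n) powr (1/4) = ?\<epsilon> n"
    using eventually_ge_at_top[of 5] by eventually_elim simp
  ultimately have "?\<epsilon> \<longlonglongrightarrow> 0" by (rule Lim_transform_eventually)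
  moreover have "real (Max (main_mult n E ` switchings n)) \<ge> real n * (1 - ?\<epsilon> n)" for n E
  proof (cases "n \<ge> 5")
    case True
    then obtain s where s: "s \<in> switchings n"
      "real (main_mult n E s) \<ge> real n - 3 * (real n / ln (real n) powr (1/4))"
      using main by blast
    have "main_mult n E s \<le> Max (main_mult n E ` switchings n)"
      using s(1) finite_switchings by (intro Max_ge) auto
    then have "real (main_mult n E s) \<le> real (Max (main_mult n E ` switchings n))" by simp
    then show ?thesis using s(2) True by (simp add: algebra_simps)
  qed simp
  ultimately show "\<exists>\<epsilon> :: nat \<Rightarrow> real. \<epsilon> \<longlonglongrightarrow> 0 \<and> (\<forall>n E. simple_graph n E \<longrightarrow>
      real (Max (main_mult n E ` switchings n)) \<ge> real n * (1 - \<epsilon> n))"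
    by blast
qed simp

end
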